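(* Let $A\in\mathbb{R}^{m\times n}$, $1\le k<\min(m,n)$, and let $\widehat A_k=\widehat V_k\widehat S_k\widehat W_k^T$ with $\widehat V_k\in\mathbb{R}^{m\times k}$, $\widehat S_k\in\mathbb{R}^{k\times k}$, $\widehat W_k\in\mathbb{R}^{n\times k}$ be an inexact rank-$k$ truncated SVD of $A$ satisfying $$\|A-\widehat V_k\widehat S_k\widehat W_k^T\|\le \theta\,\sigma_{k+1}+\phi$$ for some real quantities $\theta,\phi$. Let $p\in\{1,\dots,m\}^k$ be a vector of row indices and $P=I(:,p)\in\mathbb{R}^{m\times k}$. Assume that $P^T\widehat V_k$ is invertible and let $\mathcal P=\widehat V_k(P^T\widehat V_k)^{-1}P^T$. Then $$\|A-\mathcal P A\|\le \|\widehat V_k\|\,\|(P^T\widehat V_k)^{-1}\|\,(\theta\,\sigma_{k+1}+\phi).$$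
   Context: $\|\cdot\|$ denotes the matrix 2-norm (spectral norm). $\sigma_{k+1}$ is the $(k+1)$-th singular value of $A$ in descending order. "Inexact truncated SVD" means only that $\widehat V_k,\widehat S_k,\widehat W_k$ are real matrices of the stated sizes satisfying the stated error bound; the columns of $\widehat V_k$ and $\widehat W_k$ are not assumed orthonormal and $\widehat S_k$ need not contain exact singular values of $A$. $I(:,p)$ is the matrix whose $j$-th column is the $p_j$-th column of the $m\times m$ identity matrix. *)

theory Defs
  imports "HOL-Analysis.Analysis" "HOL-Computational_Algebra.Polynomial"
begin

definition spectral_norm :: "real^'n^'m \<Rightarrow> real" where
  "spectral_norm A = onorm ((*v) A)"

text \<open>The determinant of \<open>x I - M\<close>, computed over the ring of real polynomials.\<close>

definition charpoly :: "real^'n^'n \<Rightarrow> real poly" where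
  "charpoly M = det (mat [:0, 1:] - (\<chi> i j. [:M $ i $ j:]))"

text \<open>
  For \<open>A\<close> of size \<open>m \<times> n\<close>: the square roots of the eigenvalues of \<open>A\<^sup>T A\<close>, in descending order and repeated
  according to multiplicity. There are \<open>n\<close> of them; the last \<open>n - min m n\<close>, all zero, are not
  counted as singular values of \<open>A\<close>.
\<close>

definition singular_values :: "real^'n^'m \<Rightarrow> real list" where
  "singular_values A =
     take (min CARD('m) CARD('n))
       (rev (sorted_list_of_multiset (image_mset sqrt (proots (charpoly (transpose A ** A))))))"

text \<open>Singular values are numbered from 1 and the value is meaningful for
  \<open>1 \<le> j \<le> min m n\<close> only.\<close>

definition singular_value :: "real^'n^'m \<Rightarrow> nat \<Rightarrow> real" where
  "singular_value A j = singular_values A ! (j - 1)"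

text \<open>The matrix \<open>I(:,p)\<close>.\<close>

definition identity_columns :: "('k \<Rightarrow> 'm) \<Rightarrow> real^'k^'m" where
  "identity_columns p = (\<chi> i j. mat 1 $ i $ p j)"

end

theory Submission
  imports Defs
begin

text \<open>
  The matrix \<open>\<P>\<close> is an oblique projection onto the column space of \<open>V\<close>, so \<open>I - \<P>\<close> annihilates
  the approximation \<open>V ** S ** transpose W\<close>, and
  \<open>A - \<P> ** A = (I - \<P>) ** (A - V ** S ** transpose W)\<close>. It remains to bound the norm of
  \<open>I - \<P>\<close> by the product of the norms of \<open>V\<close> and of the inverse of \<open>transpose P ** V\<close>. Estimating
  \<open>I - \<P>\<close> by the triangle inequality would lose a summand \<open>1\<close>. Instead, a nonzero
  projection \<open>Q\<close> of an inner product space satisfies \<open>\<parallel>I - Q\<parallel> \<le> \<parallel>Q\<parallel>\<close>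
  (\<open>onorm_complementary_projection_le\<close>), and \<open>\<P>\<close> is nonzero because it fixes the columns of
  \<open>V\<close>, which cannot all vanish when \<open>transpose P ** V\<close> is invertible. Finally, this
  invertibility forces the selected row indices to be distinct, so \<open>transpose P\<close> only discards
  and reorders coordinates and has norm at most \<open>1\<close> (\<open>spectral_norm_row_selection_le_1\<close>).
\<close>

text \<open>
  Split \<open>x = u + w\<close> with \<open>u\<close> in the range and \<open>w\<close> in the kernel of \<open>Q\<close>; the claim is
  \<open>\<parallel>w\<parallel> \<le> \<parallel>Q\<parallel> \<parallel>x\<parallel>\<close>. If \<open>u = 0\<close>, then \<open>x = w\<close>, and \<open>\<parallel>Q\<parallel> \<ge> 1\<close> because \<open>Q\<close> fixes the nonzero
  vector \<open>Q z\<close>. If both parts are nonzero, rescaling to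
  \<open>y = (\<parallel>w\<parallel> / \<parallel>u\<parallel>) u + (\<parallel>u\<parallel> / \<parallel>w\<parallel>) w\<close> exchanges the lengths of the two
  components and keeps their inner product, so \<open>\<parallel>y\<parallel> = \<parallel>x\<parallel>\<close>, while \<open>\<parallel>Q y\<parallel> = \<parallel>w\<parallel>\<close>.
\<close>
lemma onorm_complementary_projection_le:
  fixes Q :: "'a::real_inner \<Rightarrow> 'a"
  assumes lin: "bounded_linear Q"
    and idem: "\<And>x. Q (Q x) = Q x"
    and nonzero: "Q z \<noteq> 0"
  shows "onorm (\<lambda>x. x - Q x) \<le> onorm Q"
proof (rule onorm_bound)
  show "0 \<le> onorm Q"
    by (rule onorm_pos_le[OF lin])
next
  fix x
  interpret bounded_linear Q by (rule lin)
  define u w where "u = Q x" and "w = x - Q x"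
  have x: "x = u + w" and Qu: "Q u = u" and Qw: "Q w = 0"
    by (simp_all add: u_def w_def diff idem)
  have bound: "norm (Q y) \<le> onorm Q * norm y" for y
    by (rule onorm[OF lin])
  consider "u = 0" | "w = 0" | "u \<noteq> 0" "w \<noteq> 0" by blast
  then have "norm w \<le> onorm Q * norm x"
  proof cases
    case 1
    have "1 \<le> onorm Q"
      using bound[of "Q z"] nonzero by (simp add: idem)
    then have "1 * norm x \<le> onorm Q * norm x"
      by (rule mult_right_mono) simp
    then show ?thesis
      using 1 x by simp
  next
    case 2
    then show ?thesis
      by (simp add: onorm_pos_le[OF lin])
  next
    case 3
    define y where "y = (norm w / norm u) *\<^sub>R u + (norm u / norm w) *\<^sub>R w"
    have "y \<bullet> y = x \<bullet> x"
    proof -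
      have "y \<bullet> y = (norm w / norm u)\<^sup>2 * (u \<bullet> u) + 2 * (norm w / norm u * (norm u / norm w)) * (u \<bullet> w)
          + (norm u / norm w)\<^sup>2 * (w \<bullet> w)"
        unfolding y_def inner_add_left inner_add_right inner_scaleR_left inner_scaleR_right
        by (simp add: inner_commute[of w u] power2_eq_square algebra_simps add_divide_distrib)
      also have "\<dots> = w \<bullet> w + 2 * (u \<bullet> w) + u \<bullet> u"
        using 3 by (simp add: power2_norm_eq_inner power_divide)
      also have "\<dots> = x \<bullet> x"
        by (simp add: x inner_add_left inner_add_right inner_commute[of w u])
      finally show ?thesis .
    qed
    then have "norm y = norm x"
      by (simp add: norm_eq_sqrt_inner)
    moreover have "Q y = (norm w / norm u) *\<^sub>R u"
      by (simp add: y_def add scaleR Qu Qw)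
    then have "norm (Q y) = norm w"
      using 3 by simp
    ultimately show ?thesis
      using bound[of y] by simp
  qed
  then show "norm (x - Q x) \<le> onorm Q * norm x"
    by (simp add: w_def)
qed

lemma spectral_norm_nonneg: "0 \<le> spectral_norm A"
  unfolding spectral_norm_def by (rule onorm_pos_le) simp

lemma spectral_norm_mult_le: "spectral_norm (A ** B) \<le> spectral_norm A * spectral_norm B"
proof -
  have "(*v) (A ** B) = (*v) A \<circ> (*v) B"
    by (simp add: fun_eq_iff matrix_vector_mul_assoc)
  then show ?thesis
    unfolding spectral_norm_def by (simp add: onorm_compose)
qed

lemma spectral_norm_complementary_projection_le:
  assumes "Q ** Q = Q" and "Q \<noteq> 0"
  shows "spectral_norm (mat 1 - Q) \<le> spectral_norm Q"
proof -
  obtain z where "Q *v z \<noteq> 0"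
    using \<open>Q \<noteq> 0\<close> by (metis matrix_eq matrix_vector_mult_0)
  moreover have "(*v) (mat 1 - Q) = (\<lambda>x. x - Q *v x)"
    by (simp add: fun_eq_iff matrix_vector_mult_diff_rdistrib)
  ultimately show ?thesis
    unfolding spectral_norm_def
    using onorm_complementary_projection_le[of "(*v) Q" z] \<open>Q ** Q = Q\<close>
    by (simp add: matrix_vector_mul_assoc)
qed

lemma row_selection_nth: "(transpose (identity_columns p) *v x) $ j = x $ p j"
  by (simp add: identity_columns_def matrix_vector_mult_def mat_def transpose_def
      mult_delta_left del: transpose_matrix_vector)

text \<open>
  An index selected twice would give \<open>transpose (identity_columns p) ** V\<close> two equal rows, which
  an invertible matrix cannot have.
\<close>
lemma inj_if_invertible_selected_rows:
  assumes "invertible (transpose (identity_columns p) ** V)"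
  shows "inj p"
proof (rule injI)
  fix i j
  assume "p i = p j"
  let ?M = "transpose (identity_columns p) ** V"
  have "(?M *v x) $ i = (?M *v x) $ j" for x
    using \<open>p i = p j\<close>
    by (simp add: matrix_vector_mul_assoc[symmetric] row_selection_nth
        del: transpose_matrix_vector)
  moreover obtain M' where "?M ** M' = mat 1"
    using assms by (auto simp: invertible_def)
  then have "?M *v (M' *v axis i 1) = axis i 1"
    by (simp only: matrix_vector_mul_assoc matrix_vector_mul_lid)
  ultimately have "(axis i 1 :: real^_) $ i = (axis i 1 :: real^_) $ j"
    by metis
  then show "i = j"
    by (simp add: axis_def split: if_splits)
qed

lemma spectral_norm_row_selection_le_1:
  fixes p :: "'a::finite \<Rightarrow> 'b::finite"
  assumes "inj p"
  shows "spectral_norm (transpose (identity_columns p)) \<le> 1"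
  unfolding spectral_norm_def
proof (rule onorm_bound)
  fix x :: "real^'b"
  have "(\<Sum>j\<in>UNIV. (x $ p j)\<^sup>2) = (\<Sum>i\<in>range p. (x $ i)\<^sup>2)"
    using assms by (simp add: sum.reindex)
  also have "\<dots> \<le> (\<Sum>i\<in>UNIV. (x $ i)\<^sup>2)"
    by (rule sum_mono2) auto
  finally show "norm (transpose (identity_columns p) *v x) \<le> 1 * norm x"
    by (simp add: norm_vec_def L2_set_def row_selection_nth del: transpose_matrix_vector)
qed simp

theorem lemma3p1:
  fixes A :: "real^'n^'m"
    and V :: "real^'k^'m" and S :: "real^'k^'k" and W :: "real^'k^'n"
    and \<theta> \<phi> :: real
    and p :: "'k \<Rightarrow> 'm"
    and P :: "real^'k^'m" and \<P> :: "real^'m^'m"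
  assumes "1 \<le> CARD('k)" and "CARD('k) < min CARD('m) CARD('n)"
    and "spectral_norm (A - V ** S ** transpose W)
           \<le> \<theta> * singular_value A (CARD('k) + 1) + \<phi>"
    and "P = identity_columns p"
    and "invertible (transpose P ** V)"
    and "\<P> = V ** matrix_inv (transpose P ** V) ** transpose P"
  shows "spectral_norm (A - \<P> ** A)
           \<le> spectral_norm V * spectral_norm (matrix_inv (transpose P ** V))
               * (\<theta> * singular_value A (CARD('k) + 1) + \<phi>)"
proof -
  define M where "M = matrix_inv (transpose P ** V)"
  define E where "E = A - V ** S ** transpose W"
  have M: "M ** (transpose P ** V) = mat 1"
    using assms(5) unfolding M_def invertible_def matrix_inv_def by (rule someI_ex[THEN conjunct2])
  have \<P>: "\<P> = V ** M ** transpose P"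
    by (simp add: assms(6) M_def)
  have \<P>V: "\<P> ** V = V"
    using M by (simp add: \<P> matrix_mul_assoc[symmetric])
  have "\<P> ** \<P> = \<P>"
  proof -
    have "\<P> ** \<P> = \<P> ** V ** M ** transpose P"
      by (simp add: \<P> matrix_mul_assoc)
    also have "\<dots> = \<P>"
      unfolding \<P>V by (rule \<P>[symmetric])
    finally show ?thesis .
  qed
  moreover have "\<P> \<noteq> 0"
  proof
    assume "\<P> = 0"
    then have "V = 0"
      using \<P>V by (simp add: matrix_matrix_mult_def vec_eq_iff)
    then have "(mat 1 :: real^'k^'k) = 0"
      using M by (simp add: matrix_matrix_mult_def vec_eq_iff)
    then show False
      by (simp add: mat_def vec_eq_iff split: if_splits)
  qed
  ultimately have "spectral_norm (mat 1 - \<P>) \<le> spectral_norm \<P>"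
    by (rule spectral_norm_complementary_projection_le)
  also have "\<dots> \<le> spectral_norm V * spectral_norm M"
  proof -
    have "spectral_norm (transpose P) \<le> 1"
      using assms(4,5) inj_if_invertible_selected_rows spectral_norm_row_selection_le_1 by blast
    have "spectral_norm \<P> \<le> spectral_norm (V ** M) * spectral_norm (transpose P)"
      unfolding \<P> by (rule spectral_norm_mult_le)
    also have "\<dots> \<le> spectral_norm (V ** M)"
      using \<open>spectral_norm (transpose P) \<le> 1\<close> by (simp add: mult_left_le spectral_norm_nonneg)
    also have "\<dots> \<le> spectral_norm V * spectral_norm M"
      by (rule spectral_norm_mult_le)
    finally show ?thesis .
  qed
  finally have complement: "spectral_norm (mat 1 - \<P>) \<le> spectral_norm V * spectral_norm M" .
  have "\<P> ** (V ** S ** transpose W) = V ** S ** transpose W"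
    by (simp add: matrix_mul_assoc \<P>V)
  then have "\<P> *v ((V ** S ** transpose W) *v x) = (V ** S ** transpose W) *v x" for x
    by (simp only: matrix_vector_mul_assoc)
  then have "(A - \<P> ** A) *v x = ((mat 1 - \<P>) ** E) *v x" for x
    by (simp add: E_def matrix_vector_mult_diff_rdistrib matrix_vector_mult_diff_distrib
        flip: matrix_vector_mul_assoc)
  then have "A - \<P> ** A = (mat 1 - \<P>) ** E"
    by (simp add: matrix_eq)
  then have "spectral_norm (A - \<P> ** A) \<le> spectral_norm (mat 1 - \<P>) * spectral_norm E"
    by (simp add: spectral_norm_mult_le)
  also have "\<dots> \<le> (spectral_norm V * spectral_norm M)
      * (\<theta> * singular_value A (CARD('k) + 1) + \<phi>)"
    using complement assms(3)
    by (intro mult_mono) (simp_all add: E_def spectral_norm_nonneg)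
  finally show ?thesis
    by (simp add: M_def)
qed

end
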